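(* For any linear congestion game with restricted altruistic social context $(\mathcal{G},\Gamma)$, normalized so that $\gamma_{ii}=1$ for all $i$, such that $\Gamma$ is symmetric, it holds $\mathsf{PoS}(\mathcal{G},\Gamma)\le 2$.
   Context: Linear congestion game: a set of players $[n]=\{1,\dots,n\}$, $n\ge 2$, a finite set $E$ of resources, for each player $i$ a non-empty set $S_i\subseteq 2^E$ of strategies (each strategy is a non-empty subset of $E$), and for each $e\in E$ a latency function $\ell_e(x)=\alpha_e x+\beta_e$ with $\alpha_e,\beta_e\ge 0$. A strategy profile is $S=(s_1,\dots,s_n)$ with $s_i\in S_i$. The congestion of $e$ in $S$ is $n_e(S)=|\{j\in[n]:e\in s_j\}|$, and the cost of player $i$ in the underlying game is $c_i(S)=\sum_{e\in s_i}(\alpha_e n_e(S)+\beta_e)$. For $t\in S_i$, $S_{-i}\diamond t$ denotes the profile obtained from $S$ by replacing $s_i$ with $t$. A linear congestion game with altruistic social context is a pair $(\mathcal{G},\Gamma)$ where $\mathcal{G}$ is a linear congestion game with $n$ players and $\Gamma=(\gamma_{ij})\in\mathbb{R}^{n\times n}$ has non-negative entries; players and strategies are those of $\mathcal{G}$, but the cost of player $i$ in $S$ is $\widehat{c}_i(S)=\sum_{j\in[n]}\gamma_{ij}\,c_j(S)$. The social context is restricted if $\gamma_{ii}\ge\gamma_{ij}$ for all $i,j$; in this case it is normalized so that $\gamma_{ii}=1$ for every $i$, so that $\gamma_{ij}\in[0,1]$. A pure Nash equilibrium of $(\mathcal{G},\Gamma)$ is a profile $S$ with $\widehat{c}_i(S)\le\widehat{c}_i(S_{-i}\diamond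 t)$ for every player $i$ and every $t\in S_i$. The social function is $\mathsf{SUM}(S)=\sum_{i\in[n]}c_i(S)$ (sum of the costs in the underlying game), and $S^*$ is a profile minimizing it. The price of stability $\mathsf{PoS}(\mathcal{G},\Gamma)$ is the minimum of $\mathsf{SUM}(S)/\mathsf{SUM}(S^* )$ over pure Nash equilibria $S$ of $(\mathcal{G},\Gamma)$; the bound $\mathsf{PoS}\le\rho$ means that there exists a pure Nash equilibrium $S$ with $\mathsf{SUM}(S)\le\rho\,\mathsf{SUM}(S^* )$. *)

theory Defs
  imports Complex_Main "HOL-Library.FuncSet"
begin

record 'e congestion_game =
  num_players :: nat
  resources :: "'e set"
  strategies :: "nat \<Rightarrow> 'e set set"
  slope :: "'e \<Rightarrow> real"
  offset :: "'e \<Rightarrow> real"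

definition players :: "'e congestion_game \<Rightarrow> nat set" where
  "players G = {1..num_players G}"

text \<open>Only the values of \<^const>\<open>strategies\<close> on players and of \<^const>\<open>slope\<close>
  and \<^const>\<open>offset\<close> on resources are constrained; other values are irrelevant.\<close>

definition linear_congestion_game :: "'e congestion_game \<Rightarrow> bool" where
  "linear_congestion_game G \<longleftrightarrow>
     num_players G \<ge> 2 \<and>
     finite (resources G) \<and>
     (\<forall>i\<in>players G. strategies G i \<noteq> {} \<and> strategies G i \<subseteq> Pow (resources G) - {{}}) \<and>
     (\<forall>e\<in>resources G. slope G e \<ge> 0 \<and> offset G e \<ge> 0)"

definition latency :: "'e congestion_game \<Rightarrow> 'e \<Rightarrow> real \<Rightarrow> real" where
  "latency G e x = slope G e * x + offset G e"

text \<open>Profiles are extensional functions, so each tuple of strategies is represented by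
  exactly one function, and replacing the strategy of player \<open>i\<close> by \<open>t\<close> is \<open>S(i := t)\<close>.\<close>

definition profiles :: "'e congestion_game \<Rightarrow> (nat \<Rightarrow> 'e set) set" where
  "profiles G = PiE (players G) (strategies G)"

definition congestion :: "'e congestion_game \<Rightarrow> (nat \<Rightarrow> 'e set) \<Rightarrow> 'e \<Rightarrow> nat" where
  "congestion G S e = card {j \<in> players G. e \<in> S j}"

definition cost :: "'e congestion_game \<Rightarrow> (nat \<Rightarrow> 'e set) \<Rightarrow> nat \<Rightarrow> real" where
  "cost G S i = (\<Sum>e\<in>S i. latency G e (real (congestion G S e)))"

definition social_cost :: "'e congestion_game \<Rightarrow> (nat \<Rightarrow> 'e set) \<Rightarrow> real" where
  "social_cost G S = (\<Sum>i\<in>players G. cost G S i)"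

definition social_optimum :: "'e congestion_game \<Rightarrow> (nat \<Rightarrow> 'e set) \<Rightarrow> bool" where
  "social_optimum G S \<longleftrightarrow>
     S \<in> profiles G \<and> (\<forall>T\<in>profiles G. social_cost G S \<le> social_cost G T)"

text \<open>A social context is a matrix indexed by the players; entries at other indices play no role.\<close>

type_synonym social_context = "nat \<Rightarrow> nat \<Rightarrow> real"

definition altruistic_context :: "'e congestion_game \<Rightarrow> social_context \<Rightarrow> bool" where
  "altruistic_context G \<Gamma> \<longleftrightarrow> (\<forall>i\<in>players G. \<forall>j\<in>players G. \<Gamma> i j \<ge> 0)"

definition restricted_context :: "'e congestion_game \<Rightarrow> social_context \<Rightarrow> bool" where
  "restricted_context G \<Gamma> \<longleftrightarrow>
     altruistic_context G \<Gamma> \<and> (\<forall>i\<in>players G. \<forall>j\<in>players G. \<Gamma> i i \<ge> \<Gamma> i j)"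

definition normalized_context :: "'e congestion_game \<Rightarrow> social_context \<Rightarrow> bool" where
  "normalized_context G \<Gamma> \<longleftrightarrow> (\<forall>i\<in>players G. \<Gamma> i i = 1)"

definition symmetric_context :: "'e congestion_game \<Rightarrow> social_context \<Rightarrow> bool" where
  "symmetric_context G \<Gamma> \<longleftrightarrow> (\<forall>i\<in>players G. \<forall>j\<in>players G. \<Gamma> i j = \<Gamma> j i)"

definition altruistic_cost ::
  "'e congestion_game \<Rightarrow> social_context \<Rightarrow> (nat \<Rightarrow> 'e set) \<Rightarrow> nat \<Rightarrow> real" where
  "altruistic_cost G \<Gamma> S i = (\<Sum>j\<in>players G. \<Gamma> i j * cost G S j)"

definition pure_nash ::
  "'e congestion_game \<Rightarrow> social_context \<Rightarrow> (nat \<Rightarrow> 'e set) \<Rightarrow> bool" where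
  "pure_nash G \<Gamma> S \<longleftrightarrow>
     S \<in> profiles G \<and>
     (\<forall>i\<in>players G. \<forall>t\<in>strategies G i.
        altruistic_cost G \<Gamma> S i \<le> altruistic_cost G \<Gamma> (S(i := t)) i)"

text \<open>The bound on the price of stability is stated without division: the optimum may have
  social cost 0, and then HOL's \<open>x / 0 = 0\<close> would make a bound on the ratio vacuous.  The
  existence of an equilibrium and of an optimum is part of the claim; the choice of the optimum
  does not matter, since all optima have the same social cost.\<close>

definition PoS_at_most :: "'e congestion_game \<Rightarrow> social_context \<Rightarrow> real \<Rightarrow> bool" where
  "PoS_at_most G \<Gamma> \<rho> \<longleftrightarrow>
     (\<exists>S S_opt. pure_nash G \<Gamma> S \<and> social_optimum G S_opt \<and>
        social_cost G S \<le> \<rho> * social_cost G S_opt)"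

end

theory Submission
  imports Defs
begin

text \<open>Write \<open>A(s, t)\<close> for the total slope on \<open>s \<inter> t\<close> and \<open>B(s)\<close> for the total offset
  on \<open>s\<close>, so that \<open>c\<^sub>i(S) = (\<Sum>k. A(s\<^sub>i, s\<^sub>k)) + B(s\<^sub>i)\<close>.  Symmetry of \<open>\<Gamma>\<close> makes
  \<open>P(S) = (\<Sum>i k. (1 + \<gamma>\<^sub>i\<^sub>k) A(s\<^sub>i, s\<^sub>k)) + 2 (\<Sum>i. B(s\<^sub>i))\<close> twice an exact potential of the
  altruistic game, and \<open>0 \<le> \<gamma>\<^sub>i\<^sub>k \<le> 1\<close> gives \<open>SUM \<le> P \<le> 2 SUM\<close>.  A minimizer \<open>S\<close> of \<open>P\<close> is
  therefore an equilibrium with \<open>SUM(S) \<le> P(S) \<le> P(S*) \<le> 2 SUM(S*)\<close>.\<close>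

definition overlap :: "'e congestion_game \<Rightarrow> 'e set \<Rightarrow> 'e set \<Rightarrow> real" where
  "overlap G s t = (\<Sum>e\<in>s \<inter> t. slope G e)"

definition fixed_cost :: "'e congestion_game \<Rightarrow> 'e set \<Rightarrow> real" where
  "fixed_cost G s = (\<Sum>e\<in>s. offset G e)"

text \<open>The double sum meets every pair of distinct players twice, so twice the potential needs
  no factor 1/2; offsets occur once per player and take an explicit 2.\<close>

definition double_potential ::
  "'e congestion_game \<Rightarrow> social_context \<Rightarrow> (nat \<Rightarrow> 'e set) \<Rightarrow> real" where
  "double_potential G \<Gamma> S =
     (\<Sum>j\<in>players G. \<Sum>k\<in>players G. (1 + \<Gamma> j k) * overlap G (S j) (S k)) +
     2 * (\<Sum>j\<in>players G. fixed_cost G (S j))"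

lemma finite_players [simp]: "finite (players G)"
  by (simp add: players_def)

lemma overlap_commute: "overlap G s t = overlap G t s"
  by (simp add: overlap_def Int_commute)

lemma profile_strategy:
  assumes "S \<in> profiles G" "i \<in> players G"
  shows "S i \<in> strategies G i"
  using assms by (auto simp: profiles_def)

lemma profile_subset_resources:
  assumes "linear_congestion_game G" "S \<in> profiles G" "i \<in> players G"
  shows "S i \<subseteq> resources G"
  using assms profile_strategy[of S G i] by (auto simp: linear_congestion_game_def)

lemma finite_profile_strategy:
  assumes "linear_congestion_game G" "S \<in> profiles G" "i \<in> players G"
  shows "finite (S i)"
  using profile_subset_resources[OF assms] assms(1)
  by (auto simp: linear_congestion_game_def intro: finite_subset)

lemma profile_update:
  assumes "S \<in> profiles G" "i \<in> players G" "t \<in> strategies G i"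
  shows "S(i := t) \<in> profiles G"
  using assms by (auto simp: profiles_def PiE_iff extensional_def)

lemma finite_profiles:
  assumes "linear_congestion_game G"
  shows "finite (profiles G)"
  unfolding profiles_def
proof (rule finite_PiE)
  fix i assume "i \<in> players G"
  then have "strategies G i \<subseteq> Pow (resources G)" "finite (resources G)"
    using assms by (auto simp: linear_congestion_game_def)
  then show "finite (strategies G i)"
    by (simp add: finite_subset)
qed simp

lemma profiles_nonempty:
  assumes "linear_congestion_game G"
  shows "profiles G \<noteq> {}"
  using assms by (auto simp: profiles_def PiE_eq_empty_iff linear_congestion_game_def)

lemma overlap_nonneg:
  assumes "linear_congestion_game G" "s \<subseteq> resources G"
  shows "overlap G s t \<ge> 0"
  unfolding overlap_def
  by (rule sum_nonneg) (use assms in \<open>auto simp: linear_congestion_game_def\<close>)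

lemma fixed_cost_nonneg:
  assumes "linear_congestion_game G" "s \<subseteq> resources G"
  shows "fixed_cost G s \<ge> 0"
  unfolding fixed_cost_def
  by (rule sum_nonneg) (use assms in \<open>auto simp: linear_congestion_game_def\<close>)

text \<open>Congestion is a sum of indicators over the players, and exchanging it with the sum over
  resources groups the slopes by pairs of strategies. Finiteness matters: a sum over an infinite
  \<open>S i\<close> is 0 by default, while its intersections may be finite.\<close>

lemma cost_eq_overlap:
  assumes "finite (S i)"
  shows "cost G S i = (\<Sum>k\<in>players G. overlap G (S i) (S k)) + fixed_cost G (S i)"
proof -
  have congestion: "real (congestion G S e) = (\<Sum>k\<in>players G. of_bool (e \<in> S k))" for e
    by (simp add: congestion_def sum.If_cases Int_def of_bool_def)
  have overlap: "overlap G (S i) (S k) = (\<Sum>e\<in>S i. slope G e * of_bool (e \<in> S k))" for k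
    using assms by (simp add: overlap_def sum.inter_restrict of_bool_def if_distrib cong: if_cong)
  show ?thesis
    unfolding cost_def latency_def congestion overlap fixed_cost_def
    by (subst sum.swap) (simp add: sum.distrib sum_distrib_left mult.commute)
qed

text \<open>Isolates all terms that involve \<open>i\<close>: by symmetry its column equals its row,
  which gives the factor 2.\<close>

lemma sum_symmetric_remove:
  fixes f :: "'a \<Rightarrow> 'a \<Rightarrow> 'b :: comm_ring_1"
  assumes "finite A" "i \<in> A" "\<And>k. k \<in> A \<Longrightarrow> f k i = f i k"
  shows "(\<Sum>j\<in>A. \<Sum>k\<in>A. f j k) =
     f i i + 2 * (\<Sum>k\<in>A - {i}. f i k) + (\<Sum>j\<in>A - {i}. \<Sum>k\<in>A - {i}. f j k)"
proof -
  have "(\<Sum>j\<in>A - {i}. f j i) = (\<Sum>k\<in>A - {i}. f i k)"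
    using assms by (intro sum.cong) auto
  then show ?thesis
    using assms(1,2) by (simp add: sum.remove[of A i] sum.distrib)
qed

text \<open>The subtrahends on the right do not depend on the strategy of player \<open>i\<close>.\<close>

lemma double_potential_minus_altruistic_cost:
  assumes "i \<in> players G" "\<And>j. j \<in> players G \<Longrightarrow> finite (S j)"
    and "normalized_context G \<Gamma>" "symmetric_context G \<Gamma>"
  defines "J \<equiv> players G - {i}"
  shows "double_potential G \<Gamma> S - 2 * altruistic_cost G \<Gamma> S i =
     (\<Sum>j\<in>J. \<Sum>k\<in>J. (1 + \<Gamma> j k) * overlap G (S j) (S k)) + 2 * (\<Sum>j\<in>J. fixed_cost G (S j)) -
     2 * (\<Sum>j\<in>J. \<Gamma> i j * ((\<Sum>k\<in>J. overlap G (S j) (S k)) + fixed_cost G (S j)))"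
proof -
  have \<Gamma>_ii: "\<Gamma> i i = 1"
    using assms by (simp add: normalized_context_def)
  have split: "(\<Sum>j\<in>players G. f j) = f i + (\<Sum>j\<in>J. f j)" for f :: "nat \<Rightarrow> real"
    using assms by (simp add: J_def sum.remove)
  have "(\<Sum>j\<in>players G. \<Sum>k\<in>players G. (1 + \<Gamma> j k) * overlap G (S j) (S k)) =
      2 * overlap G (S i) (S i) + 2 * (\<Sum>k\<in>J. (1 + \<Gamma> i k) * overlap G (S i) (S k)) +
      (\<Sum>j\<in>J. \<Sum>k\<in>J. (1 + \<Gamma> j k) * overlap G (S j) (S k))"
    using assms \<Gamma>_ii
    by (subst sum_symmetric_remove[where i = i])
      (auto simp: J_def symmetric_context_def overlap_commute)
  \<comment> \<open>The overlap of \<open>S i\<close> and \<open>S k\<close> enters once through the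
    cost of \<open>i\<close> itself and, weighted by \<open>\<Gamma> i k\<close>, once more through
    the cost of \<open>k\<close>; hence the factor \<open>1 + \<Gamma> i k\<close>.\<close>
  moreover have "altruistic_cost G \<Gamma> S i =
      overlap G (S i) (S i) + (\<Sum>k\<in>J. (1 + \<Gamma> i k) * overlap G (S i) (S k)) +
      fixed_cost G (S i) +
      (\<Sum>j\<in>J. \<Gamma> i j * ((\<Sum>k\<in>J. overlap G (S j) (S k)) + fixed_cost G (S j)))"
  proof -
    have "altruistic_cost G \<Gamma> S i = (\<Sum>j\<in>players G. \<Gamma> i j *
        ((\<Sum>k\<in>players G. overlap G (S j) (S k)) + fixed_cost G (S j)))"
      using assms by (simp add: altruistic_cost_def cost_eq_overlap)
    moreover have "overlap G (S k) (S i) = overlap G (S i) (S k)" if "k \<in> J" for k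
      by (rule overlap_commute)
    ultimately show ?thesis
      by (simp add: split \<Gamma>_ii algebra_simps sum.distrib)
  qed
  ultimately show ?thesis
    by (simp add: double_potential_def split algebra_simps)
qed

text \<open>The potential minus \<open>2 * altruistic_cost\<close> depends only on the strategies of
  the other players, so it agrees before and after the deviation.\<close>

lemma double_potential_deviation:
  assumes "linear_congestion_game G" "normalized_context G \<Gamma>" "symmetric_context G \<Gamma>"
    and "S \<in> profiles G" "i \<in> players G" "t \<in> strategies G i"
  shows "double_potential G \<Gamma> (S(i := t)) - double_potential G \<Gamma> S =
    2 * (altruistic_cost G \<Gamma> (S(i := t)) i - altruistic_cost G \<Gamma> S i)"
proof -
  have "S(i := t) \<in> profiles G"
    using assms by (simp add: profile_update)
  then have "double_potential G \<Gamma> (S(i := t)) - 2 * altruistic_cost G \<Gamma> (S(i := t)) i =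
      double_potential G \<Gamma> S - 2 * altruistic_cost G \<Gamma> S i"
    using assms finite_profile_strategy[OF assms(1)]
    \<comment> \<open>Both profiles are rewritten with the update kept intact; evaluating it
      afterwards changes nothing on players other than \<open>i\<close>.\<close>
    by (simp add: double_potential_minus_altruistic_cost del: fun_upd_apply) simp
  then show ?thesis
    by simp
qed

lemma social_cost_eq_overlap:
  assumes "linear_congestion_game G" "S \<in> profiles G"
  shows "social_cost G S =
    (\<Sum>j\<in>players G. \<Sum>k\<in>players G. overlap G (S j) (S k)) +
    (\<Sum>j\<in>players G. fixed_cost G (S j))"
  using assms by (simp add: social_cost_def cost_eq_overlap finite_profile_strategy sum.distrib)

text \<open>The potential only adds nonnegative terms: overlaps weighted by
  \<open>\<Gamma> j k\<close>, and the offsets a second time.\<close>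

lemma social_cost_le_double_potential:
  assumes "linear_congestion_game G" "altruistic_context G \<Gamma>" "S \<in> profiles G"
  shows "social_cost G S \<le> double_potential G \<Gamma> S"
proof -
  note subset = profile_subset_resources[OF assms(1,3)]
  have "(\<Sum>j\<in>players G. \<Sum>k\<in>players G. overlap G (S j) (S k)) \<le>
      (\<Sum>j\<in>players G. \<Sum>k\<in>players G. (1 + \<Gamma> j k) * overlap G (S j) (S k))"
    using assms subset
    by (intro sum_mono) (simp add: altruistic_context_def overlap_nonneg distrib_right)
  moreover have "0 \<le> (\<Sum>j\<in>players G. fixed_cost G (S j))"
    using assms subset by (intro sum_nonneg fixed_cost_nonneg)
  ultimately show ?thesis
    using assms by (simp add: social_cost_eq_overlap double_potential_def)
qed

lemma double_potential_le_social_cost: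
  assumes "linear_congestion_game G" "restricted_context G \<Gamma>" "normalized_context G \<Gamma>"
    and "S \<in> profiles G"
  shows "double_potential G \<Gamma> S \<le> 2 * social_cost G S"
proof -
  note subset = profile_subset_resources[OF assms(1,4)]
  \<comment> \<open>Restriction bounds each entry by the diagonal entry of its row, which is 1; this
    caps the weights \<open>1 + \<Gamma> j k\<close> at 2.\<close>
  have "\<Gamma> j k \<le> 1" if "j \<in> players G" "k \<in> players G" for j k
    using assms that by (auto simp: restricted_context_def normalized_context_def)
  then have "(\<Sum>j\<in>players G. \<Sum>k\<in>players G. (1 + \<Gamma> j k) * overlap G (S j) (S k)) \<le>
      (\<Sum>j\<in>players G. \<Sum>k\<in>players G. 2 * overlap G (S j) (S k))"
    using assms subset by (intro sum_mono mult_right_mono) (simp_all add: overlap_nonneg)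
  then show ?thesis
    using assms
    by (simp add: social_cost_eq_overlap double_potential_def sum_distrib_left distrib_left)
qed

theorem theorem6:
  fixes G :: "'e congestion_game" and \<Gamma> :: social_context
  assumes "linear_congestion_game G"
    and "restricted_context G \<Gamma>"
    and "normalized_context G \<Gamma>"
    and "symmetric_context G \<Gamma>"
  shows "PoS_at_most G \<Gamma> 2"
proof -
  \<comment> \<open>Stated for any \<open>f\<close>, since it yields both the equilibrium
    (minimizing the potential) and the optimum (minimizing social cost).\<close>
  have minimizer: "\<exists>S\<in>profiles G. \<forall>T\<in>profiles G. f S \<le> f T" for f :: "_ \<Rightarrow> real"
    using ex_is_arg_min_if_finite[OF finite_profiles[OF assms(1)] profiles_nonempty[OF assms(1)],
        of f]
    by (auto simp: is_arg_min_linorder)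
  obtain S where S: "S \<in> profiles G"
    and min: "\<And>T. T \<in> profiles G \<Longrightarrow> double_potential G \<Gamma> S \<le> double_potential G \<Gamma> T"
    using minimizer by blast
  obtain S_opt where opt: "social_optimum G S_opt"
    using minimizer[of "social_cost G"] by (auto simp: social_optimum_def)
  then have S_opt: "S_opt \<in> profiles G"
    by (simp add: social_optimum_def)
  have "altruistic_cost G \<Gamma> S i \<le> altruistic_cost G \<Gamma> (S(i := t)) i"
    if "i \<in> players G" "t \<in> strategies G i" for i t
    using double_potential_deviation[OF assms(1,3,4) S that] min[OF profile_update[OF S that]]
    by simp
  then have "pure_nash G \<Gamma> S"
    using S by (simp add: pure_nash_def)
  moreover have "social_cost G S \<le> 2 * social_cost G S_opt"
  proof -
    have "social_cost G S \<le> double_potential G \<Gamma> S"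
      using assms S by (simp add: social_cost_le_double_potential restricted_context_def)
    also have "\<dots> \<le> double_potential G \<Gamma> S_opt"
      using min S_opt .
    also have "\<dots> \<le> 2 * social_cost G S_opt"
      using assms S_opt by (intro double_potential_le_social_cost)
    finally show ?thesis .
  qed
  ultimately show ?thesis
    using opt by (auto simp: PoS_at_most_def)
qed

end
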